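(* Let $m=0$ and let $a(\eta)=\alpha\eta$ for $\eta>0$, with $\alpha>0$ a constant (radiation-filled, spatially flat cosmos). Let $\vec k\in\mathbb{R}^3\setminus\{0\}$, $k=|\vec k|$. Then $g_k(\eta)=\frac{1}{\sqrt{2k}}e^{-ik\eta}$ satisfies the mode equation and the Wronskian normalization given in the context, $$\lim_{\Lambda\to\infty}\frac{|\langle g_k,\bar g_k\rangle_{\eta,\Lambda}|}{\langle g_k,g_k\rangle_{\eta,\Lambda}}=0,$$ and consequently the S-J mode functions with cutoff $\Lambda$ built from $g_k$ converge pointwise, as $\Lambda\to\infty$, to $$\mathcal{U}^{SJ}_{\vec k}(\eta,\vec x)=\frac{1}{\sqrt{(2\pi)^3\,2k}\;a(\eta)}\,e^{-i(k\eta-\vec k\cdot\vec x)} .$$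
   Context: The spacetime is $\{(\eta,\vec x):\eta>0,\ \vec x\in\mathbb{R}^3\}$ with metric $ds^2=a(\eta)^2[d\eta^2-d\vec x^2]$; the field is a free scalar of mass $m\ge 0$ satisfying $(\nabla^\mu\nabla_\mu+m^2)\phi=0$. A mode $u_{\vec k}(\eta,\vec x)=\frac{e^{i\vec k\cdot\vec x}}{(2\pi)^{3/2}}\frac{g_k(\eta)}{a(\eta)}$ is used, where $g_k$ satisfies the mode equation $\left(\partial_\eta^2+k^2+m^2a^2-\frac{a''}{a}\right)g_k=0$ and the Wronskian normalization $g_k\,\partial_\eta\bar g_k-\bar g_k\,\partial_\eta g_k=i$ (bar is complex conjugation). For a cutoff $\Lambda>0$ put $\langle f,h\rangle_{\eta,\Lambda}=\int_0^\Lambda \bar f(\eta)h(\eta)a(\eta)^2\,d\eta$. With $r_\Lambda=\frac{|\langle g_k,\bar g_k\rangle_{\eta,\Lambda}|}{\langle g_k,g_k\rangle_{\eta,\Lambda}}$ (so $0\le r_\Lambda<1$), the S-J mode function with cutoff $\Lambda$ (obtained by diagonalizing the integral operator $i\Delta$, where $\Delta$ is the Pauli-Jordan function, on the slab $0<\eta<\Lambda$) is $$\mathcal{U}^{SJ,\Lambda}_{\vec k}(\eta,\vec x)=\frac{e^{i\vec k\cdot\vec x}}{\sqrt{2(2\pi)^3}\,a(\eta)}\left\{\sqrt{1+\tfrac{1}{\sqrt{1-r_\Lambda^2}}}\;g_k(\eta)-\sqrt{-1+\tfrac{1}{\sqrt{1-r_\Lambda^2}}}\;e^{i\,\mathrm{Arg}\langle\bar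 g_k,g_k\rangle_{\eta,\Lambda}}\;\bar g_k(\eta)\right\}.$$ (When $\langle\bar g_k,g_k\rangle_{\eta,\Lambda}=0$ the second coefficient vanishes and the value of $\mathrm{Arg}$ is irrelevant.) *)

theory Defs
  imports "HOL-Analysis.Analysis"
begin

text \<open>
  Conformal time is the half-line \<open>\<eta> > 0\<close>. Scale factors and time-dependent mode
  functions are total functions on \<open>real\<close>; only their values at \<open>\<eta> > 0\<close> matter below.
\<close>

definition mode_equation ::
  "real \<Rightarrow> (real \<Rightarrow> real) \<Rightarrow> real \<Rightarrow> (real \<Rightarrow> complex) \<Rightarrow> bool" where
  "mode_equation m a k g \<longleftrightarrow>
    (\<exists>g' g'' a' a''. \<forall>\<eta>>0.
       (g has_vector_derivative g' \<eta>) (at \<eta>) \<and>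
       (g' has_vector_derivative g'' \<eta>) (at \<eta>) \<and>
       (a has_real_derivative a' \<eta>) (at \<eta>) \<and>
       (a' has_real_derivative a'' \<eta>) (at \<eta>) \<and>
       g'' \<eta> + of_real (k\<^sup>2 + m\<^sup>2 * (a \<eta>)\<^sup>2 - a'' \<eta> / a \<eta>) * g \<eta> = 0)"

definition wronskian_normalized :: "(real \<Rightarrow> complex) \<Rightarrow> bool" where
  "wronskian_normalized g \<longleftrightarrow>
    (\<forall>\<eta>>0. g differentiable (at \<eta>) \<and>
       g \<eta> * vector_derivative (\<lambda>t. cnj (g t)) (at \<eta>)
         - cnj (g \<eta>) * vector_derivative g (at \<eta>) = \<i>)"

definition cutoff_inner ::
  "(real \<Rightarrow> real) \<Rightarrow> real \<Rightarrow> (real \<Rightarrow> complex) \<Rightarrow> (real \<Rightarrow> complex) \<Rightarrow> complex" where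
  "cutoff_inner a \<Lambda> f h =
    (LINT \<eta>:{0<..<\<Lambda>}|lborel. cnj (f \<eta>) * h \<eta> * of_real ((a \<eta>)\<^sup>2))"

text \<open>
  The denominator is the integral of \<open>\<bar>g\<bar>\<^sup>2 a\<^sup>2\<close>, hence already real; \<open>Re\<close> only changes its type.
\<close>

definition sj_ratio :: "(real \<Rightarrow> real) \<Rightarrow> (real \<Rightarrow> complex) \<Rightarrow> real \<Rightarrow> real" where
  "sj_ratio a g \<Lambda> =
    cmod (cutoff_inner a \<Lambda> g (\<lambda>\<eta>. cnj (g \<eta>))) / Re (cutoff_inner a \<Lambda> g g)"

text \<open>
  Positive-frequency eigenfunctions of \<open>\<i>\<Delta>\<close> (\<open>\<Delta>\<close> the Pauli-Jordan function) on the slab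
  \<open>0 < \<eta> < \<Lambda>\<close>, written as a Bogoliubov transform of a mode solution \<open>g\<close>. If the argument of
  \<open>Arg\<close> is \<open>0\<close>, then so is the coefficient of the phase, and the convention \<open>Arg 0 = 0\<close> is immaterial.
\<close>

definition sj_mode ::
  "(real \<Rightarrow> real) \<Rightarrow> (real \<Rightarrow> complex) \<Rightarrow> real^3 \<Rightarrow> real \<Rightarrow> real \<Rightarrow> real^3 \<Rightarrow> complex" where
  "sj_mode a g k \<Lambda> \<eta> x =
    exp (\<i> * of_real (k \<bullet> x)) / of_real (sqrt (2 * (2 * pi) ^ 3) * a \<eta>) *
    (of_real (sqrt (1 + 1 / sqrt (1 - (sj_ratio a g \<Lambda>)\<^sup>2))) * g \<eta>
     - of_real (sqrt (- 1 + 1 / sqrt (1 - (sj_ratio a g \<Lambda>)\<^sup>2)))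
       * exp (\<i> * of_real (Arg (cutoff_inner a \<Lambda> (\<lambda>t. cnj (g t)) g))) * cnj (g \<eta>))"

end

theory Submission
  imports Defs "HOL-Real_Asymp.Real_Asymp"
begin

text \<open>
  For \<open>a \<eta> = \<alpha> \<eta>\<close> one has \<open>a'' = 0\<close>, so the massless mode equation is that of a harmonic oscillator.
  The product \<open>\<langle>g, g\<rangle>\<close> integrates \<open>\<eta>\<^sup>2\<close> and grows like \<open>\<Lambda>\<^sup>3\<close>, whereas the oscillating integrand
  \<open>\<eta>\<^sup>2 exp (2 \<i> k \<eta>)\<close> of \<open>\<langle>g, cnj g\<rangle>\<close> has a primitive of size \<open>O(\<Lambda>\<^sup>2)\<close>. Hence their ratio vanishes as
  \<open>\<Lambda> \<rightarrow> \<infinity>\<close>, and with it the coefficient of \<open>cnj g\<close> in the S-J mode; its phase need not converge.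
\<close>

text \<open>For \<open>a \<le> b\<close> the interval integral unfolds to the set integral over the
  open interval, which is the form of the domain in \<open>cutoff_inner\<close>.\<close>

lemma set_integral_open_interval_FTC:
  fixes f F :: "real \<Rightarrow> complex"
  assumes "a \<le> b"
    and "\<And>x. (F has_vector_derivative f x) (at x)"
    and "continuous_on {a..b} f"
  shows "(LINT x:{a<..<b}|lborel. f x) = F b - F a"
proof -
  have "(LBINT x=ereal a..ereal b. f x) = F b - F a"
    by (rule interval_integral_FTC_finite)
      (use assms in \<open>auto intro: has_vector_derivative_at_within\<close>)
  then show ?thesis
    using assms(1) by (simp add: interval_lebesgue_integral_def)
qed

lemma integral_square_mult_exp:
  fixes c :: complex
  assumes "c \<noteq> 0" "\<Lambda> \<ge> 0"
  shows "(LINT x:{0<..<\<Lambda>}|lborel. of_real (x\<^sup>2) * exp (c * of_real x))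
    = exp (c * of_real \<Lambda>) * (of_real (\<Lambda>\<^sup>2) / c - 2 * of_real \<Lambda> / c\<^sup>2 + 2 / c ^ 3) - 2 / c ^ 3"
proof -
  \<comment> \<open>This primitive results from integrating by parts twice; the term
    \<open>2 / c ^ 3\<close> subtracted in the statement is its value at 0. It is differentiated
    over the complex plane and then restricted to the real line.\<close>
  let ?F = "\<lambda>z. exp (c * z) * (z\<^sup>2 / c - 2 * z / c\<^sup>2 + 2 / c ^ 3)"
  have "(?F has_field_derivative (z\<^sup>2 * exp (c * z))) (at z)" for z
    using assms(1)
    by (auto intro!: derivative_eq_intros simp: field_simps power2_eq_square power3_eq_cube)
  from has_vector_derivative_real_field[OF this]
  have "((\<lambda>x. ?F (of_real x)) has_vector_derivative (of_real (x\<^sup>2) * exp (c * of_real x))) (at x)"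
    for x :: real
    by simp
  then show ?thesis
    by (subst set_integral_open_interval_FTC[where F = "\<lambda>x. ?F (of_real x)"])
      (use assms(2) in \<open>auto intro!: continuous_intros\<close>)
qed

text \<open>For imaginary \<open>c\<close> the exponential has modulus 1, so the explicit value can
  be estimated term by term. The 4 collects the constant terms of the primitive at both endpoints.
  The growth is only quadratic in the cutoff.\<close>

lemma norm_integral_square_mult_cis_le:
  fixes w \<Lambda> :: real
  assumes "w > 0" "\<Lambda> \<ge> 0"
  shows "cmod (LINT x:{0<..<\<Lambda>}|lborel. of_real (x\<^sup>2) * exp (\<i> * of_real w * of_real x))
    \<le> \<Lambda>\<^sup>2 / w + 2 * \<Lambda> / w\<^sup>2 + 4 / w ^ 3"
proof -
  define c where "c = \<i> * complex_of_real w"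
  have c: "c \<noteq> 0" "cmod c = w"
    using assms(1) by (auto simp: c_def norm_mult)
  have e: "cmod (exp (c * of_real \<Lambda>)) = 1"
    by (simp add: c_def)
  have "cmod (exp (c * of_real \<Lambda>) * (of_real (\<Lambda>\<^sup>2) / c - 2 * of_real \<Lambda> / c\<^sup>2 + 2 / c ^ 3) - 2 / c ^ 3)
    \<le> cmod (of_real (\<Lambda>\<^sup>2) / c - 2 * of_real \<Lambda> / c\<^sup>2 + 2 / c ^ 3) + cmod (2 / c ^ 3)"
    using norm_triangle_ineq4[of "exp (c * of_real \<Lambda>) * (of_real (\<Lambda>\<^sup>2) / c - 2 * of_real \<Lambda> / c\<^sup>2 + 2 / c ^ 3)" "2 / c ^ 3"]
    by (simp only: norm_mult e mult_1_left)
  also have "\<dots> \<le> cmod (of_real (\<Lambda>\<^sup>2) / c) + cmod (2 * of_real \<Lambda> / c\<^sup>2) + cmod (2 / c ^ 3) + cmod (2 / c ^ 3)"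
    by (intro add_right_mono order.trans[OF norm_triangle_ineq] norm_triangle_ineq4)
  also have "\<dots> = \<Lambda>\<^sup>2 / w + 2 * \<Lambda> / w\<^sup>2 + 4 / w ^ 3"
    using assms by (simp add: norm_divide norm_mult norm_power c)
  finally show ?thesis
    using integral_square_mult_exp[OF c(1) assms(2)] by (simp add: c_def)
qed

lemma cutoff_inner_cong:
  assumes "\<And>x. x > 0 \<Longrightarrow> cnj (f x) * h x * of_real ((a x)\<^sup>2) = C * u x"
  shows "cutoff_inner a \<Lambda> f h = C * (LINT x:{0<..<\<Lambda>}|lborel. u x)"
proof -
  have "cutoff_inner a \<Lambda> f h = (LINT x:{0<..<\<Lambda>}|lborel. C * u x)"
    unfolding cutoff_inner_def
    by (rule set_lebesgue_integral_cong) (use assms in auto)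
  then show ?thesis
    by simp
qed

text \<open>Here \<open>\<kappa>\<close> stands for the norm of the wave vector: the time-dependent
  factor of the mode sees nothing else of it.\<close>

context
  fixes \<alpha> \<kappa> :: real and a :: "real \<Rightarrow> real" and g :: "real \<Rightarrow> complex"
  assumes \<alpha>: "\<alpha> > 0" and \<kappa>: "\<kappa> > 0"
    and a: "\<And>\<eta>. \<eta> > 0 \<Longrightarrow> a \<eta> = \<alpha> * \<eta>"
    and g: "\<And>\<eta>. \<eta> > 0 \<Longrightarrow> g \<eta> = of_real (1 / sqrt (2 * \<kappa>)) * exp (- \<i> * of_real (\<kappa> * \<eta>))"
begin

lemma plane_wave_has_vector_derivative:
  assumes "\<eta> > 0"
  shows "(g has_vector_derivative - \<i> * of_real \<kappa> * g \<eta>) (at \<eta>)"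
proof -
  have "((\<lambda>z. of_real (1 / sqrt (2 * \<kappa>)) * exp (- \<i> * (of_real \<kappa> * z))) has_field_derivative
      - \<i> * of_real \<kappa> * (of_real (1 / sqrt (2 * \<kappa>)) * exp (- \<i> * (of_real \<kappa> * z)))) (at z)" for z
    using \<kappa> by (auto intro!: derivative_eq_intros)
  from has_vector_derivative_real_field[OF this]
  have "((\<lambda>x. of_real (1 / sqrt (2 * \<kappa>)) * exp (- \<i> * of_real (\<kappa> * x))) has_vector_derivative
      - \<i> * of_real \<kappa> * g \<eta>) (at \<eta>)"
    by (simp add: g[OF assms])
  then show ?thesis
    \<comment> \<open>The explicit formula for \<open>g\<close> holds on an open half-line, so it
      determines the derivative at each of its points.\<close>
    by (rule has_vector_derivative_transform_within_open[where S = "{0<..}"])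
      (use assms in \<open>auto simp: g\<close>)
qed

lemma cnj_plane_wave:
  assumes "\<eta> > 0"
  shows "cnj (g \<eta>) = of_real (1 / sqrt (2 * \<kappa>)) * exp (\<i> * of_real (\<kappa> * \<eta>))"
  by (simp add: g[OF assms] exp_cnj)

text \<open>The opposite phases cancel. The resulting constant modulus serves both the Wronskian and
  the diagonal product.\<close>

lemma cnj_plane_wave_mult:
  assumes "\<eta> > 0"
  shows "cnj (g \<eta>) * g \<eta> = of_real (1 / (2 * \<kappa>))"
proof -
  have "cnj (g \<eta>) * g \<eta> = of_real (1 / sqrt (2 * \<kappa>) * (1 / sqrt (2 * \<kappa>)))
      * (exp (\<i> * of_real (\<kappa> * \<eta>)) * exp (- \<i> * of_real (\<kappa> * \<eta>)))"
    unfolding cnj_plane_wave[OF assms] unfolding g[OF assms] by (simp only: of_real_mult ac_simps)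
  also have "exp (\<i> * of_real (\<kappa> * \<eta>)) * exp (- \<i> * of_real (\<kappa> * \<eta>)) = 1"
    by (simp flip: exp_add)
  also have "1 / sqrt (2 * \<kappa>) * (1 / sqrt (2 * \<kappa>)) = 1 / (2 * \<kappa>)"
    using \<kappa> by simp
  finally show ?thesis
    by simp
qed

text \<open>Equal phases add up, which doubles the frequency: the oscillatory bound is later applied
  with \<open>w = 2 * \<kappa>\<close>.\<close>

lemma cnj_plane_wave_squared:
  assumes "\<eta> > 0"
  shows "cnj (g \<eta>) * cnj (g \<eta>) = of_real (1 / (2 * \<kappa>)) * exp (\<i> * of_real (2 * \<kappa>) * of_real \<eta>)"
proof -
  have "cnj (g \<eta>) * cnj (g \<eta>) = of_real (1 / sqrt (2 * \<kappa>) * (1 / sqrt (2 * \<kappa>)))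
      * (exp (\<i> * of_real (\<kappa> * \<eta>)) * exp (\<i> * of_real (\<kappa> * \<eta>)))"
    unfolding cnj_plane_wave[OF assms] by (simp only: of_real_mult ac_simps)
  also have "exp (\<i> * of_real (\<kappa> * \<eta>)) * exp (\<i> * of_real (\<kappa> * \<eta>))
      = exp (\<i> * of_real (2 * \<kappa>) * of_real \<eta>)"
    by (simp add: algebra_simps flip: exp_add)
  also have "1 / sqrt (2 * \<kappa>) * (1 / sqrt (2 * \<kappa>)) = 1 / (2 * \<kappa>)"
    using \<kappa> by simp
  finally show ?thesis .
qed

lemma radiation_mode_equation: "mode_equation 0 a \<kappa> g"
  unfolding mode_equation_def
\<comment> \<open>The witnesses are g', g'', a' and a'', in this order. Each time derivative
  multiplies \<open>g\<close> by \<open>- \<i> * of_real \<kappa>\<close>, so g'' is -\<kappa>^2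
  times \<open>g\<close> and cancels the frequency term, while linear growth of \<open>a\<close>
  makes a'' vanish.\<close>
proof (rule exI[of _ "\<lambda>\<eta>. - \<i> * of_real \<kappa> * g \<eta>"],
    rule exI[of _ "\<lambda>\<eta>. - \<i> * of_real \<kappa> * (- \<i> * of_real \<kappa> * g \<eta>)"],
    rule exI[of _ "\<lambda>_. \<alpha>"], rule exI[of _ "\<lambda>_. 0"], intro allI impI conjI)
  fix \<eta> :: real
  assume \<eta>: "\<eta> > 0"
  show "(g has_vector_derivative - \<i> * of_real \<kappa> * g \<eta>) (at \<eta>)"
    by (rule plane_wave_has_vector_derivative[OF \<eta>])
  then show "((\<lambda>\<eta>. - \<i> * of_real \<kappa> * g \<eta>) has_vector_derivative
      - \<i> * of_real \<kappa> * (- \<i> * of_real \<kappa> * g \<eta>)) (at \<eta>)"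
    by (rule has_vector_derivative_mult_right)
  have "((\<lambda>x. \<alpha> * x) has_real_derivative \<alpha>) (at \<eta>)"
    by (auto intro!: derivative_eq_intros)
  then show "(a has_real_derivative \<alpha>) (at \<eta>)"
    by (rule has_field_derivative_transform_within_open[where S = "{0<..}"])
      (use \<eta> in \<open>auto simp: a\<close>)
  show "- \<i> * of_real \<kappa> * (- \<i> * of_real \<kappa> * g \<eta>)
      + of_real (\<kappa>\<^sup>2 + 0\<^sup>2 * (a \<eta>)\<^sup>2 - 0 / a \<eta>) * g \<eta> = 0"
    by (simp add: power2_eq_square algebra_simps)
qed auto

lemma plane_wave_wronskian_normalized: "wronskian_normalized g"
  unfolding wronskian_normalized_def
proof (intro allI impI conjI)
  fix \<eta> :: real
  assume \<eta>: "\<eta> > 0"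
  note d = plane_wave_has_vector_derivative[OF \<eta>]
  show "g differentiable (at \<eta>)"
    using d by (rule differentiableI_vector)
  have "((\<lambda>t. cnj (g t)) has_vector_derivative \<i> * of_real \<kappa> * cnj (g \<eta>)) (at \<eta>)"
    using has_vector_derivative_cnj[OF d] by simp
  \<comment> \<open>Both terms contribute the same multiple of the squared modulus 1/(2\<kappa>);
    this is where the prefactor of \<open>g\<close> is fixed.\<close>
  then have "g \<eta> * vector_derivative (\<lambda>t. cnj (g t)) (at \<eta>) - cnj (g \<eta>) * vector_derivative g (at \<eta>)
      = 2 * \<i> * of_real \<kappa> * (cnj (g \<eta>) * g \<eta>)"
    using d by (simp add: vector_derivative_at algebra_simps)
  also have "\<dots> = \<i>"
    using \<kappa> by (simp add: cnj_plane_wave_mult[OF \<eta>])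
  finally show "g \<eta> * vector_derivative (\<lambda>t. cnj (g t)) (at \<eta>)
      - cnj (g \<eta>) * vector_derivative g (at \<eta>) = \<i>" .
qed

lemma cutoff_inner_plane_wave:
  assumes "\<Lambda> \<ge> 0"
  shows "cutoff_inner a \<Lambda> g g = of_real (\<alpha>\<^sup>2 / (2 * \<kappa>) * (\<Lambda> ^ 3 / 3))"
proof -
  have "cutoff_inner a \<Lambda> g g
      = of_real (\<alpha>\<^sup>2 / (2 * \<kappa>)) * (LINT x:{0<..<\<Lambda>}|lborel. of_real (x\<^sup>2))"
    by (rule cutoff_inner_cong) (simp add: cnj_plane_wave_mult a power_mult_distrib)
  also have "(LINT x:{0<..<\<Lambda>}|lborel. complex_of_real (x\<^sup>2)) = of_real (\<Lambda> ^ 3 / 3) - of_real (0 ^ 3 / 3)"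
  proof (rule set_integral_open_interval_FTC[OF assms])
    fix x :: real
    have "((\<lambda>z::complex. z ^ 3 / 3) has_field_derivative z\<^sup>2) (at z)" for z
      by (auto intro!: derivative_eq_intros simp: power2_eq_square)
    from has_vector_derivative_real_field[OF this, of x]
    show "((\<lambda>x. complex_of_real (x ^ 3 / 3)) has_vector_derivative of_real (x\<^sup>2)) (at x)"
      by simp
  qed (intro continuous_intros)
  finally show ?thesis
    by simp
qed

lemma norm_cutoff_inner_cnj_plane_wave_le:
  assumes "\<Lambda> \<ge> 0"
  shows "cmod (cutoff_inner a \<Lambda> g (\<lambda>t. cnj (g t)))
    \<le> \<alpha>\<^sup>2 / (2 * \<kappa>) * (\<Lambda>\<^sup>2 / (2 * \<kappa>) + 2 * \<Lambda> / (2 * \<kappa>)\<^sup>2 + 4 / (2 * \<kappa>) ^ 3)"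
proof -
  have "cutoff_inner a \<Lambda> g (\<lambda>t. cnj (g t)) = of_real (\<alpha>\<^sup>2 / (2 * \<kappa>))
      * (LINT x:{0<..<\<Lambda>}|lborel. of_real (x\<^sup>2) * exp (\<i> * of_real (2 * \<kappa>) * of_real x))"
    by (rule cutoff_inner_cong)
      (simp only: cnj_plane_wave_squared a, simp add: power_mult_distrib)
  then have "cmod (cutoff_inner a \<Lambda> g (\<lambda>t. cnj (g t))) = \<alpha>\<^sup>2 / (2 * \<kappa>)
      * cmod (LINT x:{0<..<\<Lambda>}|lborel. of_real (x\<^sup>2) * exp (\<i> * of_real (2 * \<kappa>) * of_real x))"
    using \<kappa> by (simp only: norm_mult norm_of_real) simp
  also have "\<dots> \<le> \<alpha>\<^sup>2 / (2 * \<kappa>) * (\<Lambda>\<^sup>2 / (2 * \<kappa>) + 2 * \<Lambda> / (2 * \<kappa>)\<^sup>2 + 4 / (2 * \<kappa>) ^ 3)"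
    by (intro mult_left_mono norm_integral_square_mult_cis_le) (use \<kappa> assms in auto)
  finally show ?thesis .
qed

lemma sj_ratio_tendsto_0: "((\<lambda>\<Lambda>. sj_ratio a g \<Lambda>) \<longlongrightarrow> 0) at_top"
proof (rule tendsto_sandwich[OF _ _ tendsto_const])
  let ?B = "\<lambda>\<Lambda>. \<Lambda>\<^sup>2 / (2 * \<kappa>) + 2 * \<Lambda> / (2 * \<kappa>)\<^sup>2 + 4 / (2 * \<kappa>) ^ 3"
  have C: "\<alpha>\<^sup>2 / (2 * \<kappa>) > 0"
    using \<alpha> \<kappa> by simp
  show "\<forall>\<^sub>F \<Lambda> in at_top. 0 \<le> sj_ratio a g \<Lambda>"
    using eventually_gt_at_top[of 0]
  proof eventually_elim
    case (elim \<Lambda>)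
    then show ?case
      using \<kappa> by (simp add: sj_ratio_def cutoff_inner_plane_wave)
  qed
  show "\<forall>\<^sub>F \<Lambda> in at_top. sj_ratio a g \<Lambda> \<le> ?B \<Lambda> / (\<Lambda> ^ 3 / 3)"
    using eventually_gt_at_top[of 0]
  proof eventually_elim
    case (elim \<Lambda>)
    have "sj_ratio a g \<Lambda> \<le> \<alpha>\<^sup>2 / (2 * \<kappa>) * ?B \<Lambda> / (\<alpha>\<^sup>2 / (2 * \<kappa>) * (\<Lambda> ^ 3 / 3))"
      unfolding sj_ratio_def cutoff_inner_plane_wave[OF less_imp_le[OF elim]] Re_complex_of_real
      by (intro divide_right_mono norm_cutoff_inner_cnj_plane_wave_le) (use elim \<kappa> in auto)
    \<comment> \<open>Both products carry the same positive factor, so the bound no longer depends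
      on \<alpha>. What remains is a quadratic over a cubic polynomial in the cutoff.\<close>
    also have "\<dots> = ?B \<Lambda> / (\<Lambda> ^ 3 / 3)"
      using C by (intro mult_divide_mult_cancel_left) linarith
    finally show ?case .
  qed
  show "((\<lambda>\<Lambda>. ?B \<Lambda> / (\<Lambda> ^ 3 / 3)) \<longlongrightarrow> 0) at_top"
    using \<kappa> by real_asymp
qed

end

text \<open>Only the decay of the ratio matters, whatever the mode: both Bogoliubov coefficients are
  continuous in it, with limits sqrt 2 and 0.\<close>

lemma sj_mode_tendsto:
  assumes "((\<lambda>\<Lambda>. sj_ratio a g \<Lambda>) \<longlongrightarrow> 0) at_top"
  shows "((\<lambda>\<Lambda>. sj_mode a g k \<Lambda> \<eta> x) \<longlongrightarrow>
    exp (\<i> * of_real (k \<bullet> x)) / of_real (sqrt ((2 * pi) ^ 3) * a \<eta>) * g \<eta>) at_top"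
proof -
  define c where "c \<Lambda> = 1 / sqrt (1 - (sj_ratio a g \<Lambda>)\<^sup>2)" for \<Lambda>
  have "((\<lambda>\<Lambda>. 1 / sqrt (1 - (sj_ratio a g \<Lambda>)\<^sup>2)) \<longlongrightarrow> 1 / sqrt (1 - 0\<^sup>2)) at_top"
    by (intro tendsto_intros assms) simp
  then have c: "(c \<longlongrightarrow> 1) at_top"
    by (simp add: c_def[abs_def])
  have "((\<lambda>\<Lambda>. sqrt (- 1 + c \<Lambda>)) \<longlongrightarrow> sqrt (- 1 + 1)) at_top"
    by (intro tendsto_intros c)
  then have "((\<lambda>\<Lambda>. complex_of_real (sqrt (- 1 + c \<Lambda>))) \<longlongrightarrow> 0) at_top"
    using tendsto_of_real by fastforce
  \<comment> \<open>Only the modulus 1 of the phase enters: a null function times a bounded one is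
    null, even if \<open>Arg\<close> jumps or oscillates with the cutoff.\<close>
  moreover have "Bfun (\<lambda>\<Lambda>. exp (\<i> * of_real (Arg (cutoff_inner a \<Lambda> (\<lambda>t. cnj (g t)) g)))) at_top"
    by (rule BfunI[where K = 1]) simp
  ultimately have "((\<lambda>\<Lambda>. of_real (sqrt (- 1 + c \<Lambda>))
      * exp (\<i> * of_real (Arg (cutoff_inner a \<Lambda> (\<lambda>t. cnj (g t)) g)))) \<longlongrightarrow> 0) at_top"
    using bounded_bilinear.Zfun_prod_Bfun[OF bounded_bilinear_mult] by (simp add: tendsto_Zfun_iff)
  then have "((\<lambda>\<Lambda>. exp (\<i> * of_real (k \<bullet> x)) / of_real (sqrt (2 * (2 * pi) ^ 3) * a \<eta>) *
      (of_real (sqrt (1 + c \<Lambda>)) * g \<eta> - of_real (sqrt (- 1 + c \<Lambda>))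
      * exp (\<i> * of_real (Arg (cutoff_inner a \<Lambda> (\<lambda>t. cnj (g t)) g))) * cnj (g \<eta>))) \<longlongrightarrow>
      exp (\<i> * of_real (k \<bullet> x)) / of_real (sqrt (2 * (2 * pi) ^ 3) * a \<eta>) *
      (of_real (sqrt (1 + 1)) * g \<eta> - 0 * cnj (g \<eta>))) at_top"
    by (intro tendsto_mult tendsto_diff tendsto_const tendsto_of_real tendsto_real_sqrt tendsto_add c)
  \<comment> \<open>The limiting coefficient \<open>sqrt (1 + 1)\<close> cancels the factor sqrt 2
    split off from the normalization.\<close>
  moreover have "exp (\<i> * of_real (k \<bullet> x)) / of_real (sqrt (2 * (2 * pi) ^ 3) * a \<eta>) *
      (of_real (sqrt (1 + 1)) * g \<eta> - 0 * cnj (g \<eta>))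
      = exp (\<i> * of_real (k \<bullet> x)) / of_real (sqrt ((2 * pi) ^ 3) * a \<eta>) * g \<eta>"
    unfolding real_sqrt_mult[of 2] by simp
  ultimately show ?thesis
    by (simp add: sj_mode_def c_def)
qed

theorem mainTheorem1:
  fixes \<alpha> :: real and a :: "real \<Rightarrow> real" and k :: "real^3" and g :: "real \<Rightarrow> complex"
  assumes "\<alpha> > 0"
    and "\<And>\<eta>. \<eta> > 0 \<Longrightarrow> a \<eta> = \<alpha> * \<eta>"
    and "k \<noteq> 0"
    and "\<And>\<eta>. \<eta> > 0 \<Longrightarrow> g \<eta> = of_real (1 / sqrt (2 * norm k)) * exp (- \<i> * of_real (norm k * \<eta>))"
  shows "mode_equation 0 a (norm k) g
    \<and> wronskian_normalized g
    \<and> ((\<lambda>\<Lambda>. cmod (cutoff_inner a \<Lambda> g (\<lambda>t. cnj (g t))) / Re (cutoff_inner a \<Lambda> g g)) \<longlongrightarrow> 0) at_top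
    \<and> (\<forall>\<eta>>0. \<forall>x. ((\<lambda>\<Lambda>. sj_mode a g k \<Lambda> \<eta> x) \<longlongrightarrow>
         of_real (1 / (sqrt ((2 * pi) ^ 3 * (2 * norm k)) * a \<eta>))
           * exp (- \<i> * of_real (norm k * \<eta> - k \<bullet> x))) at_top)"
proof (intro conjI allI impI)
  have \<kappa>: "norm k > 0"
    using assms(3) by simp
  note radiation = \<open>\<alpha> > 0\<close> \<kappa> assms(2) assms(4)
  show "mode_equation 0 a (norm k) g"
    by (rule radiation_mode_equation[OF radiation])
  show "wronskian_normalized g"
    by (rule plane_wave_wronskian_normalized[OF radiation])
  have r: "((\<lambda>\<Lambda>. sj_ratio a g \<Lambda>) \<longlongrightarrow> 0) at_top"
    by (rule sj_ratio_tendsto_0[OF radiation])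
  then show "((\<lambda>\<Lambda>. cmod (cutoff_inner a \<Lambda> g (\<lambda>t. cnj (g t))) / Re (cutoff_inner a \<Lambda> g g)) \<longlongrightarrow> 0) at_top"
    by (simp add: sj_ratio_def)
  fix \<eta> :: real and x :: "real^3"
  assume \<eta>: "\<eta> > 0"
  have "exp (- \<i> * of_real (norm k * \<eta> - k \<bullet> x))
      = exp (\<i> * of_real (k \<bullet> x)) * exp (- \<i> * of_real (norm k * \<eta>))"
    by (simp add: algebra_simps flip: exp_add)
  \<comment> \<open>The spatial and temporal phases merge into one exponential, and the prefactor of
    \<open>g\<close> supplies the factor \<open>2 * norm k\<close> under the root.\<close>
  then have "exp (\<i> * of_real (k \<bullet> x)) / of_real (sqrt ((2 * pi) ^ 3) * a \<eta>) * g \<eta>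
      = of_real (1 / (sqrt ((2 * pi) ^ 3 * (2 * norm k)) * a \<eta>))
        * exp (- \<i> * of_real (norm k * \<eta> - k \<bullet> x))"
    unfolding assms(4)[OF \<eta>] real_sqrt_mult[of "(2 * pi) ^ 3"] by simp
  then show "((\<lambda>\<Lambda>. sj_mode a g k \<Lambda> \<eta> x) \<longlongrightarrow>
      of_real (1 / (sqrt ((2 * pi) ^ 3 * (2 * norm k)) * a \<eta>))
        * exp (- \<i> * of_real (norm k * \<eta> - k \<bullet> x))) at_top"
    using sj_mode_tendsto[OF r, of k \<eta> x] by simp
qed

end
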